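(* For integers $n\ge 1$ and $k\ge 1$, let $M_{n,2k}$ be the number of $n\times 2k$ matrices with entries in $\{+1,-1\}$ such that each row contains exactly $k$ entries $+1$ and $k$ entries $-1$, and no two columns are identical. Let $c_{n,k}$ be the real number defined by \[ M_{n,2k}=\binom{2k}{k}^n\left(1-c_{n,k}\frac{k^2}{2^n}\right). \] Then for each fixed integer $k\ge 3$, there exists $N$ such that $c_{n,k}>c_{n+1,k}$ for all $n\ge N$. *)

theory Defs
  imports Complex_Main "Jordan_Normal_Form.Matrix"
begin

definition balanced_sign_mats :: "nat \<Rightarrow> nat \<Rightarrow> int mat set" where
  "balanced_sign_mats n k =
     {A \<in> carrier_mat n (2 * k).
        (\<forall>i<n. \<forall>j<2 * k. A $$ (i, j) \<in> {1, -1}) \<and>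
        (\<forall>i<n. card {j. j < 2 * k \<and> A $$ (i, j) = 1} = k \<and>
               card {j. j < 2 * k \<and> A $$ (i, j) = -1} = k) \<and>
        distinct (cols A)}"

text \<open>The second argument is half the number of columns: \<open>M_count n k\<close> is $M_{n,2k}$.\<close>

definition M_count :: "nat \<Rightarrow> nat \<Rightarrow> nat" where
  "M_count n k = card (balanced_sign_mats n k)"

end

theory Submission
  imports Defs
begin

text \<open>
  Identify a row with the \<open>k\<close>-subset of columns carrying \<open>+1\<close>. For a pair \<open>e\<close> of columns let \<open>b\<close>
  be the number of rows agreeing on \<open>e\<close>; it does not depend on \<open>e\<close>. A matrix has a repeated column
  iff, for some \<open>e\<close>, all its rows agree on \<open>e\<close>. As \<open>k \<ge> 3\<close>, agreement on \<open>e\<close> does not force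
  agreement on another pair, so at most \<open>(b - 1)^n\<close> matrices have all rows agreeing on two given
  pairs. With \<open>m\<close> pairs, the first two Bonferroni inequalities put the number \<open>U n\<close> of
  matrices with a repeated column between \<open>m b^n - m\<^sup>2 (b - 1)^n\<close> and \<open>m b^n\<close>. Now
  \<open>c n > c (n + 1)\<close> says \<open>2 U (n + 1) < B U n\<close> for \<open>B = (2k choose k)\<close>, which
  holds for large \<open>n\<close> because \<open>2 b < B\<close>.
\<close>

section \<open>A Bonferroni lower bound for unions\<close>

lemma Bonferroni_lower_card:
  assumes "finite I" and "\<And>i. i \<in> I \<Longrightarrow> finite (A i)"
  shows "(\<Sum>i\<in>I. card (A i)) \<le> card (\<Union>i\<in>I. A i) + (\<Sum>i\<in>I. \<Sum>j\<in>I - {i}. card (A i \<inter> A j))"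
  using assms
proof (induction I rule: finite_induct)
  case empty
  then show ?case by simp
next
  case (insert x I)
  have "card (A x \<inter> (\<Union>i\<in>I. A i)) = card (\<Union>i\<in>I. A x \<inter> A i)"
    by (rule arg_cong[where f = card]) auto
  also have "\<dots> \<le> (\<Sum>i\<in>I. card (A x \<inter> A i))"
    by (rule card_UN_le[OF insert.hyps(1)])
  finally have inter: "card (A x \<inter> (\<Union>i\<in>I. A i)) \<le> (\<Sum>i\<in>I. card (A x \<inter> A i))" .
  have "card (A x) + card (\<Union>i\<in>I. A i)
      = card (A x \<union> (\<Union>i\<in>I. A i)) + card (A x \<inter> (\<Union>i\<in>I. A i))"
    using insert by (intro card_Un_Int) auto
  \<comment> \<open>The error term runs over ordered pairs, so it holds each overlap with
    \<open>A x\<close> twice. One copy already pays for the induction step; the other is dropped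
    here.\<close>
  moreover have "(\<Sum>i\<in>I. \<Sum>j\<in>I - {i}. card (A i \<inter> A j))
      \<le> (\<Sum>i\<in>I. \<Sum>j\<in>insert x I - {i}. card (A i \<inter> A j))"
    using insert.hyps by (intro sum_mono sum_mono2) auto
  moreover have "insert x I - {x} = I"
    using insert.hyps by auto
  ultimately show ?case
    using insert inter by simp
qed

section \<open>Balanced rows and the pairs of columns they agree on\<close>

definition balanced_rows :: "nat \<Rightarrow> nat set set" where
  "balanced_rows k = {S. S \<subseteq> {..<2 * k} \<and> card S = k}"

definition column_pairs :: "nat \<Rightarrow> (nat \<times> nat) set" where
  "column_pairs k = {(a, b). a < b \<and> b < 2 * k}"

definition agreeing_rows :: "nat \<Rightarrow> nat \<times> nat \<Rightarrow> nat set set" where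
  "agreeing_rows k e = {S \<in> balanced_rows k. fst e \<in> S \<longleftrightarrow> snd e \<in> S}"

text \<open>Extensional functions make the family for each fixed pair a product, whose size is a
  plain \<open>n\<close>-th power.\<close>

definition repeated_column_mats :: "nat \<Rightarrow> nat \<Rightarrow> (nat \<Rightarrow> nat set) set" where
  "repeated_column_mats n k = (\<Union>e\<in>column_pairs k. PiE {..<n} (\<lambda>_. agreeing_rows k e))"

lemma finite_balanced_rows [simp]: "finite (balanced_rows k)"
  unfolding balanced_rows_def by (rule finite_subset[of _ "Pow {..<2 * k}"]) auto

lemma card_balanced_rows: "card (balanced_rows k) = (2 * k) choose k"
  unfolding balanced_rows_def using n_subsets[of "{..<2 * k}" k] by simp

lemma finite_column_pairs [simp]: "finite (column_pairs k)"
  unfolding column_pairs_def by (rule finite_subset[of _ "{..<2 * k} \<times> {..<2 * k}"]) auto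

lemma agreeing_rows_subset: "agreeing_rows k e \<subseteq> balanced_rows k"
  by (auto simp: agreeing_rows_def)

lemma finite_agreeing_rows [simp]: "finite (agreeing_rows k e)"
  using agreeing_rows_subset finite_balanced_rows by (rule finite_subset)

text \<open>Once the trace \<open>T\<close> on \<open>P\<close> is prescribed, \<open>S\<close> is
  determined by \<open>S - P\<close>, an arbitrary subset of \<open>V - P\<close> of the remaining
  size.\<close>

lemma card_subsets_with_trace:
  assumes "finite V" "T \<subseteq> P" "P \<subseteq> V" "card T \<le> k"
  shows "card {S. S \<subseteq> V \<and> card S = k \<and> S \<inter> P = T} = card (V - P) choose (k - card T)"
proof -
  have fin: "finite T" "finite P"
    using assms by (meson finite_subset)+
  have "bij_betw (\<lambda>S. S \<union> T) {S. S \<subseteq> V - P \<and> card S = k - card T}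
      {S. S \<subseteq> V \<and> card S = k \<and> S \<inter> P = T}"
  proof (rule bij_betw_byWitness[where f' = "\<lambda>S. S - P"])
    show "(\<lambda>S. S \<union> T) ` {S. S \<subseteq> V - P \<and> card S = k - card T}
        \<subseteq> {S. S \<subseteq> V \<and> card S = k \<and> S \<inter> P = T}"
    proof (clarify, intro conjI)
      fix S assume S: "S \<subseteq> V - P" "card S = k - card T"
      show "card (S \<union> T) = k"
        using S assms fin by (subst card_Un_disjoint) (auto dest: finite_subset)
    qed (use assms in auto)
    show "(\<lambda>S. S - P) ` {S. S \<subseteq> V \<and> card S = k \<and> S \<inter> P = T}
        \<subseteq> {S. S \<subseteq> V - P \<and> card S = k - card T}"
      using fin by (auto simp: card_Diff_subset_Int)
  qed (use assms in auto)
  then have "card {S. S \<subseteq> V \<and> card S = k \<and> S \<inter> P = T} = card {S. S \<subseteq> V - P \<and> card S = k - card T}"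
    by (simp add: bij_betw_same_card)
  then show ?thesis
    using n_subsets[of "V - P"] assms(1) by simp
qed

text \<open>The two summands count the rows containing both columns of the pair and those containing
  neither.\<close>

lemma card_agreeing_rows:
  assumes "e \<in> column_pairs k" "k \<ge> 2"
  shows "card (agreeing_rows k e) = ((2 * k - 2) choose (k - 2)) + ((2 * k - 2) choose k)"
proof -
  obtain a b where e: "e = (a, b)" "a < b" "b < 2 * k"
    using assms by (auto simp: column_pairs_def)
  let ?F = "\<lambda>T. {S. S \<subseteq> {..<2 * k} \<and> card S = k \<and> S \<inter> {a, b} = T}"
  have split: "agreeing_rows k e = ?F {a, b} \<union> ?F {}"
    by (auto simp: agreeing_rows_def balanced_rows_def e)
  have fin: "finite (?F T)" for T
    by (rule finite_subset[of _ "Pow {..<2 * k}"]) auto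
  have "card (agreeing_rows k e) = card (?F {a, b}) + card (?F {})"
    unfolding split by (rule card_Un_disjoint[OF fin fin]) auto
  moreover have "card (?F T) = (2 * k - 2) choose (k - card T)" if "T \<subseteq> {a, b}" "card T \<le> k" for T
    using card_subsets_with_trace[of "{..<2 * k}" T "{a, b}" k] that e
    by (simp add: card_Diff_subset numeral_2_eq_2)
  from this[of "{a, b}"] this[of "{}"]
  have "card (?F {a, b}) = (2 * k - 2) choose (k - 2)" "card (?F {}) = (2 * k - 2) choose k"
    using e assms(2) by (simp_all only: card.empty card_2_iff) (auto simp: numeral_2_eq_2)
  ultimately show ?thesis
    by simp
qed

text \<open>Pascal's rule applied twice writes the right side as the two outer coefficients plus
  twice the middle one, and the middle one strictly exceeds each outer one.\<close>

lemma twice_agreeing_less_central_binomial: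
  assumes "k \<ge> 2"
  shows "2 * (((2 * k - 2) choose (k - 2)) + ((2 * k - 2) choose k)) < (2 * k) choose k"
proof -
  obtain j where k: "k = Suc (Suc j)"
    using assms by (metis add_2_eq_Suc le_Suc_ex)
  have "(2 * j + 2) choose j < (2 * j + 2) choose (j + 1)"
    by (rule binomial_strict_mono) auto
  moreover have "(2 * j + 2) choose (j + 2) < (2 * j + 2) choose (j + 1)"
    by (rule binomial_strict_antimono) auto
  ultimately show ?thesis
    by (simp add: k)
qed

text \<open>Some endpoint of \<open>e'\<close> lies outside \<open>e\<close>, so it can be put into
  a row that omits the other endpoint and still agrees on \<open>e\<close>. For \<open>k = 2\<close>
  this fails: agreement on a pair and on its complement are equivalent.\<close>

lemma agreeing_rows_not_subset:
  assumes e: "e \<in> column_pairs k" and e': "e' \<in> column_pairs k" and "e \<noteq> e'" and "k \<ge> 3"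
  shows "\<exists>S \<in> agreeing_rows k e. S \<notin> agreeing_rows k e'"
proof -
  obtain a b where ab: "e = (a, b)" "a < b" "b < 2 * k"
    using e by (auto simp: column_pairs_def)
  obtain c d where cd: "e' = (c, d)" "c < d" "d < 2 * k"
    using e' by (auto simp: column_pairs_def)
  have row: "\<exists>S \<in> balanced_rows k. (a \<in> S \<longleftrightarrow> b \<in> S) \<and> y \<in> S \<and> x \<notin> S"
    if y: "y \<notin> {a, b}" "y \<noteq> x" "y < 2 * k" "x < 2 * k" for x y
  proof -
    \<comment> \<open>\<open>T\<close> must lie in the row and \<open>X\<close> must avoid it. If
      omitting \<open>x\<close> omits one of \<open>a\<close>, \<open>b\<close>, the other is
      omitted too; otherwise both are included. The row exists because 3 \<le> k \<le> 2k -
      2.\<close>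
    define T where "T = (if x \<in> {a, b} then {y} else {a, b, y})"
    define X where "X = (if x \<in> {a, b} then {a, b} else {x})"
    have "card T \<le> 3" "card X \<le> 2" "finite X" "X \<subseteq> {..<2 * k}" "T \<subseteq> {..<2 * k} - X"
      using y ab by (auto simp: T_def X_def card_insert_if)
    moreover from this have "card ({..<2 * k} - X) \<ge> k"
      using \<open>k \<ge> 3\<close> by (simp add: card_Diff_subset)
    ultimately obtain S where "T \<subseteq> S" "S \<subseteq> {..<2 * k} - X" "card S = k"
      using exists_subset_between[of T k "{..<2 * k} - X"] \<open>k \<ge> 3\<close> by auto
    then show ?thesis
      by (intro bexI[of _ S])
        (auto simp: T_def X_def balanced_rows_def split: if_splits)
  qed
  have "d \<notin> {a, b} \<or> c \<notin> {a, b}"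
    using ab cd \<open>e \<noteq> e'\<close> by auto
  then show ?thesis
    using row[of d c] row[of c d] ab cd by (auto simp: agreeing_rows_def)
qed

section \<open>Bounds on the number of matrices with a repeated column\<close>

lemma card_repeated_column_mats_le:
  assumes "k \<ge> 2"
  shows "card (repeated_column_mats n k) \<le> card (column_pairs k) *
    (((2 * k - 2) choose (k - 2)) + ((2 * k - 2) choose k)) ^ n"
proof -
  have "card (repeated_column_mats n k)
      \<le> (\<Sum>e\<in>column_pairs k. card (PiE {..<n} (\<lambda>_. agreeing_rows k e)))"
    unfolding repeated_column_mats_def by (rule card_UN_le) simp
  also have "\<dots> = (\<Sum>e\<in>column_pairs k. (((2 * k - 2) choose (k - 2)) + ((2 * k - 2) choose k)) ^ n)"
    by (rule sum.cong) (simp_all add: card_PiE card_agreeing_rows assms)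
  finally show ?thesis by simp
qed

lemma card_repeated_column_mats_ge:
  assumes "k \<ge> 3"
  defines "b \<equiv> ((2 * k - 2) choose (k - 2)) + ((2 * k - 2) choose k)"
  shows "card (column_pairs k) * b ^ n
    \<le> card (repeated_column_mats n k) + (card (column_pairs k))\<^sup>2 * (b - 1) ^ n"
proof -
  let ?A = "\<lambda>e. PiE {..<n} (\<lambda>_. agreeing_rows k e)"
  let ?P = "column_pairs k"
  have card_agree: "card (agreeing_rows k e) = b" if "e \<in> ?P" for e
    using card_agreeing_rows[OF that] assms by simp
  have inter: "card (?A e \<inter> ?A e') \<le> (b - 1) ^ n" if e: "e \<in> ?P" "e' \<in> ?P - {e}" for e e'
  proof -
    have "agreeing_rows k e \<inter> agreeing_rows k e' \<subset> agreeing_rows k e"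
      using agreeing_rows_not_subset[of e k e'] e assms by auto
    then have "card (agreeing_rows k e \<inter> agreeing_rows k e') < b"
      using psubset_card_mono[OF finite_agreeing_rows] card_agree[OF e(1)] by metis
    then show ?thesis
      by (simp add: PiE_Int card_PiE power_mono)
  qed
  have "card ?P * b ^ n = (\<Sum>e\<in>?P. card (?A e))"
    by (simp add: card_PiE card_agree)
  also have "\<dots> \<le> card (\<Union>e\<in>?P. ?A e) + (\<Sum>e\<in>?P. \<Sum>e'\<in>?P - {e}. card (?A e \<inter> ?A e'))"
    by (rule Bonferroni_lower_card) (auto intro!: finite_PiE)
  also have "(\<Sum>e\<in>?P. \<Sum>e'\<in>?P - {e}. card (?A e \<inter> ?A e')) \<le> (\<Sum>e\<in>?P. \<Sum>e'\<in>?P - {e}. (b - 1) ^ n)"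
    by (intro sum_mono inter)
  \<comment> \<open>Allowing the diagonal terms replaces m(m - 1) by the simpler m^2, where m is the
    number of pairs.\<close>
  also have "\<dots> \<le> (\<Sum>e\<in>?P. \<Sum>e'\<in>?P. (b - 1) ^ n)"
    by (intro sum_mono sum_mono2) auto
  also have "\<dots> = (card ?P)\<^sup>2 * (b - 1) ^ n"
    by (simp add: power2_eq_square)
  finally show ?thesis
    by (simp add: repeated_column_mats_def)
qed

section \<open>Translation between sign matrices and families of rows\<close>

lemma M_count_eq_card:
  "M_count n k = card (PiE {..<n} (\<lambda>_. balanced_rows k) - repeated_column_mats n k)"
proof -
  define G where "G = PiE {..<n} (\<lambda>_. balanced_rows k) - repeated_column_mats n k"
  \<comment> \<open>\<open>F\<close> and \<open>H\<close> are mutually inverse; \<open>H\<close> is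
    restricted to row indices below \<open>n\<close> so that its values are extensional.\<close>
  define F where "F = (\<lambda>f. mat n (2 * k) (\<lambda>(i, j). if j \<in> f i then 1 else (-1::int)))"
  define H where "H = (\<lambda>A::int mat. \<lambda>i\<in>{..<n}. {j. j < 2 * k \<and> A $$ (i, j) = 1})"
  have G_iff: "f \<in> G \<longleftrightarrow> f \<in> PiE {..<n} (\<lambda>_. balanced_rows k) \<and>
      (\<forall>a b. a < b \<longrightarrow> b < 2 * k \<longrightarrow> (\<exists>i<n. (a \<in> f i) \<noteq> (b \<in> f i)))" for f
  proof -
    have "f \<in> repeated_column_mats n k \<longleftrightarrow>
        (\<exists>a b. a < b \<and> b < 2 * k \<and> (\<forall>i<n. a \<in> f i \<longleftrightarrow> b \<in> f i))"
      if "f \<in> PiE {..<n} (\<lambda>_. balanced_rows k)"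
      using that by (simp add: repeated_column_mats_def column_pairs_def agreeing_rows_def
          PiE_iff Bex_def lessThan_def)
    then show ?thesis
      unfolding G_def by blast
  qed
  have distinct_iff: "distinct (cols A) \<longleftrightarrow>
      (\<forall>a b. a < b \<longrightarrow> b < 2 * k \<longrightarrow> (\<exists>i<n. A $$ (i, a) \<noteq> A $$ (i, b)))"
    if A: "A \<in> carrier_mat n (2 * k)" for A :: "int mat"
  proof -
    have "distinct (cols A) \<longleftrightarrow> (\<forall>a b. a < b \<longrightarrow> b < 2 * k \<longrightarrow> col A a \<noteq> col A b)"
      using A unfolding distinct_conv_nth
      by (auto simp: cols_length) (metis nat_neq_iff)
    also have "\<dots> \<longleftrightarrow> (\<forall>a b. a < b \<longrightarrow> b < 2 * k \<longrightarrow> (\<exists>i<n. A $$ (i, a) \<noteq> A $$ (i, b)))"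
      using A by (auto simp: vec_eq_iff)
    finally show ?thesis .
  qed
  have "bij_betw F G (balanced_sign_mats n k)"
  proof (rule bij_betw_byWitness[where f' = H])
    show "\<forall>f\<in>G. H (F f) = f"
    proof
      fix f assume "f \<in> G"
      then have f: "f \<in> PiE {..<n} (\<lambda>_. balanced_rows k)"
        by (simp add: G_def)
      show "H (F f) = f"
      proof
        fix i show "H (F f) i = f i"
        proof (cases "i < n")
          case True
          then have "f i \<subseteq> {..<2 * k}"
            using f by (auto simp: balanced_rows_def)
          then show ?thesis
            using True by (auto simp: H_def F_def split: if_splits)
        next
          case False
          then show ?thesis
            using f by (auto simp: H_def PiE_def extensional_def)
        qed
      qed
    qed
    show "\<forall>A\<in>balanced_sign_mats n k. F (H A) = A"
    proof
      fix A assume "A \<in> balanced_sign_mats n k"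
      then have carr: "A \<in> carrier_mat n (2 * k)"
        and entries: "\<And>i j. i < n \<Longrightarrow> j < 2 * k \<Longrightarrow> A $$ (i, j) = 1 \<or> A $$ (i, j) = -1"
        by (auto simp: balanced_sign_mats_def)
      show "F (H A) = A"
      proof (rule eq_matI)
        fix i j assume "i < dim_row A" "j < dim_col A"
        then show "F (H A) $$ (i, j) = A $$ (i, j)"
          using carr entries[of i j] by (auto simp: F_def H_def)
      qed (use carr in \<open>auto simp: F_def\<close>)
    qed
    show "F ` G \<subseteq> balanced_sign_mats n k"
    proof clarify
      fix f assume f: "f \<in> G"
      have carr: "F f \<in> carrier_mat n (2 * k)"
        by (simp add: F_def)
      have "card {j. j < 2 * k \<and> F f $$ (i, j) = 1} = k \<and>
          card {j. j < 2 * k \<and> F f $$ (i, j) = -1} = k" if i: "i < n" for i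
      proof -
        have fi: "f i \<subseteq> {..<2 * k}" "card (f i) = k"
          using f i by (auto simp: G_iff balanced_rows_def)
        have "{j. j < 2 * k \<and> F f $$ (i, j) = 1} = f i"
          "{j. j < 2 * k \<and> F f $$ (i, j) = -1} = {..<2 * k} - f i"
          using fi i by (auto simp: F_def split: if_splits)
        moreover have "card ({..<2 * k} - f i) = k"
          using fi by (simp add: card_Diff_subset finite_subset[OF fi(1)])
        ultimately show ?thesis
          using fi by simp
      qed
      moreover have "distinct (cols (F f))"
        unfolding distinct_iff[OF carr]
      proof (intro allI impI)
        fix a b assume ab: "a < b" "b < 2 * k"
        then obtain i where "i < n" "(a \<in> f i) \<noteq> (b \<in> f i)"
          using f unfolding G_iff by blast
        then show "\<exists>i<n. F f $$ (i, a) \<noteq> F f $$ (i, b)"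
          using ab by (intro exI[of _ i]) (auto simp: F_def)
      qed
      moreover have "\<forall>i<n. \<forall>j<2 * k. F f $$ (i, j) \<in> {1, -1}"
        by (simp add: F_def)
      ultimately show "F f \<in> balanced_sign_mats n k"
        using carr by (simp add: balanced_sign_mats_def)
    qed
    show "H ` balanced_sign_mats n k \<subseteq> G"
    proof clarify
      fix A assume A: "A \<in> balanced_sign_mats n k"
      then have carr: "A \<in> carrier_mat n (2 * k)" and "distinct (cols A)"
        and entries: "\<And>i j. i < n \<Longrightarrow> j < 2 * k \<Longrightarrow> A $$ (i, j) = 1 \<or> A $$ (i, j) = -1"
        by (auto simp: balanced_sign_mats_def)
      have "H A \<in> PiE {..<n} (\<lambda>_. balanced_rows k)"
        using A by (auto simp: H_def balanced_rows_def balanced_sign_mats_def)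
      moreover have "\<exists>i<n. (a \<in> H A i) \<noteq> (b \<in> H A i)" if ab: "a < b" "b < 2 * k" for a b
      proof -
        obtain i where "i < n" "A $$ (i, a) \<noteq> A $$ (i, b)"
          using \<open>distinct (cols A)\<close> ab unfolding distinct_iff[OF carr] by blast
        then show ?thesis
          using ab entries[of i a] entries[of i b] by (intro exI[of _ i]) (auto simp: H_def)
      qed
      ultimately show "H A \<in> G"
        by (simp add: G_iff)
    qed
  qed
  then show ?thesis
    unfolding M_count_def G_def by (simp add: bij_betw_same_card)
qed

lemma M_count_add_repeated:
  "M_count n k + card (repeated_column_mats n k) = ((2 * k) choose k) ^ n"
proof -
  let ?R = "PiE {..<n} (\<lambda>_. balanced_rows k)"
  have sub: "repeated_column_mats n k \<subseteq> ?R"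
    unfolding repeated_column_mats_def
    by (intro UN_least PiE_mono agreeing_rows_subset)
  have "finite ?R" by (simp add: finite_PiE)
  moreover have "card ?R = ((2 * k) choose k) ^ n"
    by (simp add: card_PiE card_balanced_rows)
  ultimately show ?thesis
    using sub card_mono[OF _ sub] by (simp add: M_count_eq_card card_Diff_subset finite_subset)
qed

section \<open>Comparison of consecutive values for large \<open>n\<close>\<close>

lemma eventually_mult_power_less_power:
  fixes x y C :: real
  assumes "0 \<le> x" "x < y"
  shows "eventually (\<lambda>n. C * x ^ n < y ^ n) sequentially"
proof -
  have "(\<lambda>n. C * (x / y) ^ n) \<longlonglongrightarrow> C * 0"
    using assms by (intro tendsto_mult tendsto_const LIMSEQ_realpow_zero) auto
  then have "eventually (\<lambda>n. C * (x / y) ^ n < 1) sequentially"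
    by (rule order_tendstoD) simp
  then show ?thesis
    by eventually_elim (use assms in \<open>simp add: power_divide field_simps\<close>)
qed

theorem theorem3p3:
  fixes c :: "nat \<Rightarrow> nat \<Rightarrow> real" and k :: nat
  assumes c_def: "\<And>n k. n \<ge> 1 \<Longrightarrow> k \<ge> 1 \<Longrightarrow>
      real (M_count n k) =
        real ((2 * k) choose k) ^ n * (1 - c n k * (real k ^ 2 / 2 ^ n))"
    and "k \<ge> 3"
  shows "\<exists>N. \<forall>n\<ge>N. c n k > c (n + 1) k"
proof -
  define B where "B = (2 * k) choose k"
  define b where "b = ((2 * k - 2) choose (k - 2)) + ((2 * k - 2) choose k)"
  define m where "m = card (column_pairs k)"
  define U where "U = (\<lambda>n. card (repeated_column_mats n k))"
  \<comment> \<open>This ensures that the truncated difference \<open>b - 1\<close> is strictly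
    below \<open>b\<close>, as the comparison of powers requires.\<close>
  have "b \<ge> 1"
    using \<open>k \<ge> 3\<close> by (simp add: b_def Suc_le_eq) linarith
  have "(0, 1) \<in> column_pairs k"
    using \<open>k \<ge> 3\<close> by (simp add: column_pairs_def)
  then have "m \<ge> 1"
    unfolding m_def Suc_le_eq One_nat_def card_gt_0_iff by auto
  have "2 * b < B"
    unfolding b_def B_def using \<open>k \<ge> 3\<close> by (intro twice_agreeing_less_central_binomial) simp
  have c_eq: "c n k = 2 ^ n * real (U n) / (real k ^ 2 * real B ^ n)" if "n \<ge> 1" for n
  proof -
    have "real (M_count n k) + real (U n) = real B ^ n"
      using M_count_add_repeated[of n k] unfolding U_def B_def
      by (metis of_nat_add of_nat_power)
    then have "real (U n) = real B ^ n * (c n k * (real k ^ 2 / 2 ^ n))"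
      using c_def[OF that, of k] \<open>k \<ge> 3\<close> by (simp add: B_def algebra_simps)
    moreover have "real B ^ n > 0"
      using \<open>2 * b < B\<close> by simp
    ultimately show ?thesis
      using \<open>k \<ge> 3\<close> by (simp add: field_simps)
  qed
  \<comment> \<open>The factor \<open>B * m\<close> is chosen so that, after multiplication by
    \<open>m\<close>, the Bonferroni error scaled by \<open>B\<close> stays below
    \<open>m * b ^ n\<close>.\<close>
  have "eventually (\<lambda>n. real (B * m) * real (b - 1) ^ n < real b ^ n) sequentially"
    using \<open>b \<ge> 1\<close> by (intro eventually_mult_power_less_power) auto
  then obtain N where N: "\<And>n. n \<ge> N \<Longrightarrow> real (B * m) * real (b - 1) ^ n < real b ^ n"
    by (auto simp: eventually_sequentially)
  \<comment> \<open>The bound 1 enters because \<open>c_def\<close> constrains \<open>c\<close> only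
    from \<open>n = 1\<close> on.\<close>
  have "c n k > c (n + 1) k" if n: "n \<ge> max N 1" for n
  proof -
    have "real (B * m * (b - 1) ^ n) < real (b ^ n)"
      using N[of n] n by simp
    then have small: "B * m * (b - 1) ^ n < b ^ n"
      by (simp only: of_nat_less_iff)
    have "B * (m * b ^ n) \<le> B * (U n + m\<^sup>2 * (b - 1) ^ n)"
      using card_repeated_column_mats_ge[OF \<open>k \<ge> 3\<close>, of n]
      by (intro mult_left_mono) (simp_all add: U_def m_def b_def)
    also have "\<dots> = B * U n + m * (B * m * (b - 1) ^ n)"
      by (simp add: algebra_simps power2_eq_square)
    also have "\<dots> < B * U n + m * b ^ n"
      using small \<open>m \<ge> 1\<close> by simp
    finally have "B * (m * b ^ n) < B * U n + m * b ^ n" .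
    \<comment> \<open>Over the integers \<open>2 * b < B\<close> leaves one spare copy of
      \<open>m * b ^ n\<close>, exactly what absorbs the error.\<close>
    moreover have "(2 * b + 1) * (m * b ^ n) \<le> B * (m * b ^ n)"
      using \<open>2 * b < B\<close> by (intro mult_right_mono) auto
    moreover have "2 * U (n + 1) \<le> 2 * b * (m * b ^ n)"
      using card_repeated_column_mats_le[of k "n + 1"] \<open>k \<ge> 3\<close>
      by (simp add: U_def m_def b_def algebra_simps)
    ultimately have "2 * U (n + 1) < B * U n"
      by (simp add: algebra_simps)
    then have "2 * real (U (n + 1)) < real B * real (U n)"
      by (metis of_nat_less_iff of_nat_mult of_nat_numeral)
    moreover have "real B > 0"
      using \<open>2 * b < B\<close> by simp
    ultimately show ?thesis
      using \<open>k \<ge> 3\<close> n by (simp add: c_eq divide_simps mult.commute)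
  qed
  then show ?thesis
    by blast
qed

end
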